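(* Let $\Delta$ be a unit-interval simplicial complex on $[n]$ with $\dim(\Delta)=d-1>1$, let $\Gamma=\mathrm{Ind}(\Delta)$, and let $B_1,\dots,B_m$ be the maximal cliques of $\Delta$. For $j\in[m]$ let $$L_j=(\mathbf{x}_Ft: F\in\Gamma\text{ and }f_j(p_F)>0)\subset R_\Gamma,$$ where $f_j(x)=-\left(\sum_{k\in B_j}x_k\right)+(d-1)x_{n+1}$ and $p_F=\sum_{i\in F}e_i+e_{n+1}\in\mathbb Z^{n+1}$, with $e_1,\dots,e_{n+1}$ the canonical basis of $\mathbb Z^{n+1}$. Then $L_j$ is a minimal monomial prime ideal of $(t)\subset R_\Gamma$ (that is, a monomial prime ideal which is a minimal prime of the ideal $(t)$), for all $j\in[m]$.
   Context: For a pure $(d-1)$-dimensional simplicial complex $\Delta$ on vertex set $[n]$: a clique is a subset $C\subseteq[n]$ all of whose $d$-subsets are facets of $\Delta$; $\mathrm{Ind}(\Delta)$ is the simplicial complex of all subsets of $[n]$ containing no facet of $\Delta$. $\Delta$ is a unit-interval simplicial complex if it is pure and for every facet $\{i_1<\cdots<i_d\}$ the interval $[i_1,i_d]=\{i_1,i_1+1,\dots,i_d\}$ is a clique of $\Delta$. "Maximal cliques of $\Delta$" means the inclusion-maximal cliques with at least $d$ elements; these are intervals. Let $K$ be a field, $S=K[x_1,\dots,x_n]$, $\mathbf{x}_F=\prod_{i\in F}x_i$ ($\mathbf{x}_\emptyset=1$), and $R_\Gamma=K[\mathbf{x}_Ft:F\in\Gamma]\subset S[t]$, which is a normal Cohen-Macaulay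 domain. A monomial ideal of $R_\Gamma$ is an ideal generated by monomials $x_1^{a_1}\cdots x_n^{a_n}t^k\in R_\Gamma$. *)

theory Defs
  imports
    "HOL-Library.Poly_Mapping"
    "HOL-Algebra.Ideal"
    "HOL-Algebra.Generated_Rings"
    "HOL-Algebra.Algebraic_Closure_Type"
begin

section \<open>Simplicial complexes on \<open>[n] = {1..n}\<close>\<close>

text \<open>Some elements of \<open>[n]\<close> may fail to be vertices: \<open>{i} \<in> \<Delta>\<close> is not required.\<close>

definition simplicial_complex_on :: "nat \<Rightarrow> nat set set \<Rightarrow> bool" where
  "simplicial_complex_on n \<Delta> \<longleftrightarrow>
     \<Delta> \<noteq> {} \<and> \<Delta> \<subseteq> Pow {1..n} \<and> (\<forall>F\<in>\<Delta>. \<forall>G. G \<subseteq> F \<longrightarrow> G \<in> \<Delta>)"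

definition complex_dim :: "nat set set \<Rightarrow> int" where
  "complex_dim \<Delta> = int (Max (card ` \<Delta>)) - 1"

definition facets :: "nat set set \<Rightarrow> nat set set" where
  "facets \<Delta> = {F \<in> \<Delta>. \<forall>G\<in>\<Delta>. F \<subseteq> G \<longrightarrow> G = F}"

definition pure :: "nat set set \<Rightarrow> bool" where
  "pure \<Delta> \<longleftrightarrow> (\<forall>F\<in>facets \<Delta>. int (card F) - 1 = complex_dim \<Delta>)"

text \<open>Below, \<open>d\<close> always stands for \<open>complex_dim \<Delta> + 1\<close>.\<close>

definition clique :: "nat \<Rightarrow> nat \<Rightarrow> nat set set \<Rightarrow> nat set \<Rightarrow> bool" where
  "clique n d \<Delta> C \<longleftrightarrow> C \<subseteq> {1..n} \<and> (\<forall>F. F \<subseteq> C \<and> card F = d \<longrightarrow> F \<in> facets \<Delta>)"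

definition maximal_cliques :: "nat \<Rightarrow> nat \<Rightarrow> nat set set \<Rightarrow> nat set set" where
  "maximal_cliques n d \<Delta> =
     {C. clique n d \<Delta> C \<and> d \<le> card C \<and> (\<forall>C'. clique n d \<Delta> C' \<and> C \<subseteq> C' \<longrightarrow> C' = C)}"

definition unit_interval_complex :: "nat \<Rightarrow> nat \<Rightarrow> nat set set \<Rightarrow> bool" where
  "unit_interval_complex n d \<Delta> \<longleftrightarrow>
     simplicial_complex_on n \<Delta> \<and> complex_dim \<Delta> = int d - 1 \<and> pure \<Delta> \<and>
     (\<forall>F\<in>facets \<Delta>. clique n d \<Delta> {Min F..Max F})"

definition Ind :: "nat \<Rightarrow> nat set set \<Rightarrow> nat set set" where
  "Ind n \<Delta> = {F. F \<subseteq> {1..n} \<and> (\<forall>G\<in>facets \<Delta>. \<not> G \<subseteq> F)}"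

section \<open>The toric ring \<open>R_\<Gamma>\<close>\<close>

text \<open>
  Polynomials over \<open>K\<close> in indeterminates indexed by \<^typ>\<open>nat\<close>. The ring \<open>S[t]\<close> is identified
  with the polynomial ring in the indeterminates \<open>1, \<dots>, n + 1\<close>: the indeterminate \<open>i \<le> n\<close> is
  \<open>x_i\<close>, and the indeterminate \<open>n + 1\<close> is \<open>t\<close>. Thus the exponent vector of \<open>x_F t\<close> is \<open>p_F\<close>.
\<close>

type_synonym 'k mpoly = "(nat \<Rightarrow>\<^sub>0 nat) \<Rightarrow>\<^sub>0 'k"

definition const :: "'k::field \<Rightarrow> 'k mpoly" where
  "const c = Poly_Mapping.single 0 c"

definition indet :: "nat \<Rightarrow> 'k::field mpoly" where
  "indet i = Poly_Mapping.single (Poly_Mapping.single i 1) 1"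

definition xt :: "nat \<Rightarrow> nat set \<Rightarrow> 'k::field mpoly" where
  "xt n F = (\<Prod>i\<in>F. indet i) * indet (n + 1)"

text \<open>\<open>K[G]\<close> is the subring generated by the constants and \<open>G\<close>.\<close>

definition toric_ring :: "nat \<Rightarrow> nat set set \<Rightarrow> 'k::field mpoly ring" where
  "toric_ring n \<Gamma> = ring_of_type_algebra
     \<lparr>carrier := generate_ring ring_of_type_algebra (range const \<union> xt n ` \<Gamma>)\<rparr>"

definition monomials :: "nat \<Rightarrow> 'k::field mpoly set" where
  "monomials n = {(\<Prod>i\<in>{1..n}. indet i ^ a i) * indet (n + 1) ^ k | a k. True}"

definition monomial_ideal :: "nat \<Rightarrow> nat set set \<Rightarrow> 'k::field mpoly set \<Rightarrow> bool" where
  "monomial_ideal n \<Gamma> I \<longleftrightarrow>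
     (\<exists>M. M \<subseteq> monomials n \<inter> carrier (toric_ring n \<Gamma>) \<and> I = genideal (toric_ring n \<Gamma>) M)"

definition minimal_prime_of :: "('a, 'b) ring_scheme \<Rightarrow> 'a set \<Rightarrow> 'a set \<Rightarrow> bool" where
  "minimal_prime_of R I P \<longleftrightarrow>
     primeideal P R \<and> I \<subseteq> P \<and> (\<forall>Q. primeideal Q R \<and> I \<subseteq> Q \<and> Q \<subseteq> P \<longrightarrow> Q = P)"

section \<open>The ideals \<open>L_j\<close>\<close>

text \<open>Elements of \<open>\<int>^(n+1)\<close> are functions \<^typ>\<open>nat \<Rightarrow> int\<close>, of which only the values on
  \<open>{1..n+1}\<close> matter.\<close>

definition basis_vec :: "nat \<Rightarrow> nat \<Rightarrow> int" where
  "basis_vec i = (\<lambda>k. if k = i then 1 else 0)"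

definition pt :: "nat \<Rightarrow> nat set \<Rightarrow> nat \<Rightarrow> int" where
  "pt n F = (\<lambda>k. (\<Sum>i\<in>F. basis_vec i k) + basis_vec (n + 1) k)"

definition lin_form :: "nat \<Rightarrow> nat \<Rightarrow> nat set \<Rightarrow> (nat \<Rightarrow> int) \<Rightarrow> int" where
  "lin_form n d B x = - (\<Sum>k\<in>B. x k) + (int d - 1) * x (n + 1)"

definition L_ideal :: "nat \<Rightarrow> nat \<Rightarrow> nat set set \<Rightarrow> nat set \<Rightarrow> 'k::field mpoly set" where
  "L_ideal n d \<Gamma> B =
     genideal (toric_ring n \<Gamma>) (xt n ` {F \<in> \<Gamma>. lin_form n d B (pt n F) > 0})"

end

theory Submission
  imports Defs
begin

text \<open>
  The form \<open>f\<^sub>j\<close> is a nonnegative integer grading of \<open>R\<^sub>\<Gamma>\<close>, and \<open>L\<^sub>j\<close> is the ideal of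
  elements without a component of degree \<open>0\<close>; it is prime because \<open>S[t]\<close> is a domain.

  For minimality let \<open>Q \<subseteq> L\<^sub>j\<close> be a prime containing \<open>t\<close>, and write \<open>u\<^sub>F\<close> for \<open>\<bold>x\<^sub>F t\<close>. If
  \<open>|G \<inter> B\<^sub>j| = d - 1\<close>, then \<open>u\<^sub>G \<notin> L\<^sub>j\<close>, hence \<open>u\<^sub>G \<notin> Q\<close>. Every \<open>u\<^sub>F\<close> with
  \<open>|F \<inter> B\<^sub>j| < d - 1\<close> lies in \<open>Q\<close>, by induction on \<open>|F|\<close> starting from \<open>u\<^sub>\<emptyset> = t\<close>. An element
  \<open>i \<in> F - B\<^sub>j\<close> is removed by \<open>u\<^sub>F u\<^sub>G = u\<^bsub>F - i\<^esub> u\<^bsub>G + i\<^esub>\<close>, where \<open>G\<close> consists of \<open>d - 1\<close>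
  elements of \<open>B\<^sub>j\<close>, one of them the end of \<open>B\<^sub>j\<close> far from \<open>i\<close>: if \<open>G + i\<close> were a facet, its
  interval would be a clique larger than \<open>B\<^sub>j\<close>. If \<open>F \<subseteq> B\<^sub>j\<close>, take \<open>j \<in> F\<close> and
  \<open>k \<in> B\<^sub>j - F\<close>: then \<open>u\<^sub>F u\<^bsub>F - j + k\<^esub> = u\<^bsub>F - j\<^esub> u\<^bsub>F + k\<^esub> \<in> Q\<close>, and
  \<open>u\<^sub>F u\<^sub>G = u\<^bsub>F - j + k\<^esub> u\<^bsub>G - k + j\<^esub>\<close> for a suitable \<open>G\<close>, so \<open>u\<^sub>F \<in> Q\<close> in either case.
\<close>

section \<open>Toric rings and their monomials\<close>

abbreviation mpoly_ring :: "'k::field mpoly ring" where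
  "mpoly_ring \<equiv> ring_of_type_algebra"

lemma poly_mapping_sum_terms:
  "p = (\<Sum>m\<in>Poly_Mapping.keys p. Poly_Mapping.single m (Poly_Mapping.lookup p m))"
  by (rule poly_mapping_eqI)
    (auto simp: lookup_sum lookup_single when_def in_keys_iff)

lemma keys_uminus:
  fixes p :: "'a \<Rightarrow>\<^sub>0 'b::ab_group_add"
  shows "Poly_Mapping.keys (- p) = Poly_Mapping.keys p"
  by (auto simp: in_keys_iff)

lemma toric_ring_simps [simp]:
  "x \<otimes>\<^bsub>toric_ring n \<Gamma>\<^esub> y = x * y"
  "x \<oplus>\<^bsub>toric_ring n \<Gamma>\<^esub> y = x + y"
  "\<one>\<^bsub>toric_ring n \<Gamma>\<^esub> = 1"
  "\<zero>\<^bsub>toric_ring n \<Gamma>\<^esub> = 0"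
  by (simp_all add: toric_ring_def ring_of_type_algebra_def)

lemma carrier_toric_ring:
  "carrier (toric_ring n \<Gamma>) = generate_ring mpoly_ring (range const \<union> xt n ` \<Gamma>)"
  by (simp add: toric_ring_def)

lemma mpoly_ring_simps:
  "x \<otimes>\<^bsub>mpoly_ring\<^esub> y = x * y" "x \<oplus>\<^bsub>mpoly_ring\<^esub> y = x + y" "\<one>\<^bsub>mpoly_ring\<^esub> = 1"
  "\<zero>\<^bsub>mpoly_ring\<^esub> = 0" "carrier mpoly_ring = UNIV"
  by (simp_all add: ring_of_type_algebra_def)

lemma mpoly_ring_uminus: "\<ominus>\<^bsub>mpoly_ring\<^esub> (x :: 'k::field mpoly) = - x"
proof -
  interpret cring "mpoly_ring :: 'k mpoly ring" by (rule cring_from_type_algebra)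
  have "- x \<oplus>\<^bsub>mpoly_ring\<^esub> x = \<zero>\<^bsub>mpoly_ring\<^esub>"
    by (simp add: mpoly_ring_simps)
  then show ?thesis
    by (intro minus_equality) (auto simp: mpoly_ring_simps)
qed

lemma cring_toric_ring: "cring (toric_ring n \<Gamma> :: 'k::field mpoly ring)"
proof -
  interpret cring "mpoly_ring :: 'k mpoly ring" by (rule cring_from_type_algebra)
  let ?H = "range const \<union> xt n ` \<Gamma> :: 'k mpoly set"
  have "subring (generate_ring mpoly_ring ?H) mpoly_ring"
    by (rule generate_ring_is_subring) (simp add: mpoly_ring_simps)
  then have "subcring (generate_ring mpoly_ring ?H) mpoly_ring"
    by (auto intro: subcringI')
  then show ?thesis
    unfolding toric_ring_def by (subst (asm) subcring_iff) (auto simp: mpoly_ring_simps)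
qed

lemma const_in_toric_ring: "const c \<in> carrier (toric_ring n \<Gamma>)"
  by (simp add: carrier_toric_ring generate_ring.incl)

lemma xt_in_toric_ring: "F \<in> \<Gamma> \<Longrightarrow> xt n F \<in> carrier (toric_ring n \<Gamma>)"
  by (simp add: carrier_toric_ring generate_ring.incl)

definition expo :: "nat \<Rightarrow> nat set \<Rightarrow> nat \<Rightarrow>\<^sub>0 nat" where
  "expo n F = (\<Sum>i\<in>F. Poly_Mapping.single i 1) + Poly_Mapping.single (n + 1) 1"

lemma prod_indet:
  "(\<Prod>i\<in>F. indet i) = Poly_Mapping.single (\<Sum>i\<in>F. Poly_Mapping.single i 1) (1 :: 'k::field)"
  by (induction F rule: infinite_finite_induct) (auto simp: indet_def mult_single)

lemma xt_eq_single: "xt n F = Poly_Mapping.single (expo n F) 1"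
  by (simp add: xt_def expo_def prod_indet) (simp add: indet_def mult_single)

text \<open>The monoid generated by the exponent vectors of the generators. Adding one generator at
  a time makes statements about monomials of the ring accessible to induction.\<close>

inductive_set toric_exps :: "nat \<Rightarrow> nat set set \<Rightarrow> (nat \<Rightarrow>\<^sub>0 nat) set"
  for n :: nat and \<Gamma> :: "nat set set" where
  zero: "0 \<in> toric_exps n \<Gamma>"
| step: "F \<in> \<Gamma> \<Longrightarrow> m \<in> toric_exps n \<Gamma> \<Longrightarrow> expo n F + m \<in> toric_exps n \<Gamma>"

lemma toric_exps_add:
  "a \<in> toric_exps n \<Gamma> \<Longrightarrow> b \<in> toric_exps n \<Gamma> \<Longrightarrow> a + b \<in> toric_exps n \<Gamma>"
  by (induction rule: toric_exps.induct) (auto simp: add.assoc intro: toric_exps.intros)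

text \<open>Polynomials supported in a fixed submonoid of exponents form a subring, and this one
  contains the constants and all generators.\<close>

lemma keys_toric_ring:
  fixes r :: "'k::field mpoly"
  assumes "r \<in> carrier (toric_ring n \<Gamma>)"
  shows "Poly_Mapping.keys r \<subseteq> toric_exps n \<Gamma>"
  using assms unfolding carrier_toric_ring
proof (induction rule: generate_ring.induct)
  case one
  then show ?case by (simp add: mpoly_ring_simps toric_exps.zero)
next
  case (incl h)
  then show ?case
    using toric_exps.step[OF _ toric_exps.zero]
    by (auto simp: const_def xt_eq_single toric_exps.zero split: if_splits)
next
  case (a_inv h)
  then show ?case by (simp add: mpoly_ring_uminus keys_uminus)
next
  case (eng_add h1 h2)
  then show ?case using keys_add[of h1 h2] by (auto simp: mpoly_ring_simps)
next
  case (eng_mult h1 h2)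
  have "x \<in> toric_exps n \<Gamma>" if x: "x \<in> Poly_Mapping.keys (h1 * h2)" for x
    using keys_mult[of h1 h2] x eng_mult.IH toric_exps_add by blast
  then show ?case by (auto simp: mpoly_ring_simps)
qed

lemma monomial_in_toric_ring:
  "m \<in> toric_exps n \<Gamma> \<Longrightarrow>
    Poly_Mapping.single m (1 :: 'k::field) \<in> carrier (toric_ring n \<Gamma>)"
proof (induction rule: toric_exps.induct)
  case zero
  interpret cring "toric_ring n \<Gamma> :: 'k mpoly ring" by (rule cring_toric_ring)
  show ?case using one_closed by simp
next
  case (step F m)
  interpret cring "toric_ring n \<Gamma> :: 'k mpoly ring" by (rule cring_toric_ring)
  have "xt n F * Poly_Mapping.single m (1::'k) \<in> carrier (toric_ring n \<Gamma>)"
    using m_closed[OF xt_in_toric_ring step.IH] step.hyps by simp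
  then show ?case by (simp add: xt_eq_single mult_single)
qed

section \<open>The prime ideal of a nonnegative grading\<close>

text \<open>For a nonnegative grading \<open>w\<close> these are the elements whose component of
  degree 0 vanishes.\<close>

definition positive_part ::
    "nat \<Rightarrow> nat set set \<Rightarrow> ((nat \<Rightarrow>\<^sub>0 nat) \<Rightarrow> int) \<Rightarrow> 'k::field mpoly set" where
  "positive_part n \<Gamma> w =
     {r \<in> carrier (toric_ring n \<Gamma>). \<forall>m\<in>Poly_Mapping.keys r. 0 < w m}"

context
  fixes n :: nat and \<Gamma> :: "nat set set" and w :: "(nat \<Rightarrow>\<^sub>0 nat) \<Rightarrow> int"
  assumes w_add: "\<And>a b. w (a + b) = w a + w b"
    and w_nonneg: "\<And>F. F \<in> \<Gamma> \<Longrightarrow> 0 \<le> w (expo n F)"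
begin

lemma weight_zero: "w 0 = 0"
  using w_add[of 0 0] by simp

lemma weight_toric_exps_nonneg: "m \<in> toric_exps n \<Gamma> \<Longrightarrow> 0 \<le> w m"
  by (induction rule: toric_exps.induct) (auto simp: weight_zero w_add w_nonneg)

text \<open>Terms of ring elements have weight at least 0, so multiplication by a ring element keeps
  positive weights positive.\<close>

lemma ideal_positive_part:
  "ideal (positive_part n \<Gamma> w :: 'k::field mpoly set) (toric_ring n \<Gamma>)"
proof -
  let ?R = "toric_ring n \<Gamma> :: 'k mpoly ring"
  interpret cring ?R by (rule cring_toric_ring)
  have mult: "x * a \<in> positive_part n \<Gamma> w"
    if "a \<in> positive_part n \<Gamma> w" "x \<in> carrier ?R" for a x
  proof -
    have "x * a \<in> carrier ?R"
      using m_closed[of x a] that by (auto simp: positive_part_def)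
    moreover have "0 < w m" if m: "m \<in> Poly_Mapping.keys (x * a)" for m
    proof -
      obtain b c where "m = b + c" "b \<in> Poly_Mapping.keys x" "c \<in> Poly_Mapping.keys a"
        using m keys_mult[of x a] by auto
      moreover from this have "0 \<le> w b"
        using keys_toric_ring \<open>x \<in> carrier ?R\<close> weight_toric_exps_nonneg by blast
      ultimately show ?thesis
        using \<open>a \<in> positive_part n \<Gamma> w\<close> by (force simp: positive_part_def w_add)
    qed
    ultimately show ?thesis by (simp add: positive_part_def)
  qed
  have add: "a + b \<in> positive_part n \<Gamma> w"
    if "a \<in> positive_part n \<Gamma> w" "b \<in> positive_part n \<Gamma> w" for a b :: "'k mpoly"
    using that a_closed[of a b] keys_add[of a b] by (auto simp: positive_part_def)
  \<comment> \<open>The inverse is rewritten as a multiple of the inverse of 1, so that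
    \<open>mult\<close> applies.\<close>
  have uminus: "\<ominus>\<^bsub>?R\<^esub> a \<in> positive_part n \<Gamma> w" if "a \<in> positive_part n \<Gamma> w" for a
  proof -
    have "a \<in> carrier ?R" using that by (simp add: positive_part_def)
    then have "\<ominus>\<^bsub>?R\<^esub> a = (\<ominus>\<^bsub>?R\<^esub> 1) * a"
      using l_minus[OF one_closed, of a] l_one[of a] unfolding toric_ring_simps by simp
    moreover have "\<ominus>\<^bsub>?R\<^esub> 1 \<in> carrier ?R" using a_inv_closed[OF one_closed] by simp
    ultimately show ?thesis using mult that by metis
  qed
  show ?thesis
  proof (rule idealI)
    show "ring ?R" by (rule ring_axioms)
    show "subgroup (positive_part n \<Gamma> w) (add_monoid ?R)"
    proof (rule add.subgroupI)
      show "positive_part n \<Gamma> w \<subseteq> carrier ?R" by (auto simp: positive_part_def)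
      have "0 \<in> (positive_part n \<Gamma> w :: 'k mpoly set)"
        using zero_closed by (simp add: positive_part_def)
      then show "(positive_part n \<Gamma> w :: 'k mpoly set) \<noteq> {}" by blast
    qed (use add uminus in auto)
  qed (use mult in \<open>auto simp: mult.commute\<close>)
qed

text \<open>The weight of a product of generators is the sum of their nonnegative weights. If it is
  positive, some factor has positive weight and lies in the ideal.\<close>

lemma monomial_in_genideal:
  assumes "m \<in> toric_exps n \<Gamma>" "0 < w m"
  shows "Poly_Mapping.single m (1 :: 'k::field)
    \<in> genideal (toric_ring n \<Gamma>) (xt n ` {F \<in> \<Gamma>. 0 < w (expo n F)})"
  using assms
proof (induction rule: toric_exps.induct)
  case zero
  then show ?case by (simp add: weight_zero)
next
  case (step F m)
  let ?R = "toric_ring n \<Gamma> :: 'k mpoly ring"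
  let ?G = "xt n ` {F \<in> \<Gamma>. 0 < w (expo n F)} :: 'k mpoly set"
  interpret cring ?R by (rule cring_toric_ring)
  have G: "?G \<subseteq> carrier ?R" using xt_in_toric_ring by auto
  interpret I: ideal "genideal ?R ?G" ?R by (rule genideal_ideal[OF G])
  have eq: "Poly_Mapping.single (expo n F + m) 1 = xt n F * Poly_Mapping.single m (1 :: 'k)"
    by (simp add: xt_eq_single mult_single)
  show ?case
  proof (cases "0 < w m")
    case True
    have "xt n F \<otimes>\<^bsub>?R\<^esub> Poly_Mapping.single m 1 \<in> genideal ?R ?G"
      using step.IH[OF True] xt_in_toric_ring[OF step.hyps(1)] by (rule I.I_l_closed)
    then show ?thesis by (simp add: eq)
  next
    case False
    then have "0 < w (expo n F)" using step.prems by (simp add: w_add)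
    then have "xt n F \<in> ?G" using step.hyps by blast
    then have "xt n F \<in> genideal ?R ?G" using genideal_self[OF G] by blast
    then have "xt n F \<otimes>\<^bsub>?R\<^esub> Poly_Mapping.single m 1 \<in> genideal ?R ?G"
      using monomial_in_toric_ring[OF step.hyps(2)] by (rule I.I_r_closed)
    then show ?thesis by (simp add: eq)
  qed
qed

lemma genideal_eq_positive_part:
  "genideal (toric_ring n \<Gamma>) (xt n ` {F \<in> \<Gamma>. 0 < w (expo n F)})
    = (positive_part n \<Gamma> w :: 'k::field mpoly set)"
proof
  let ?R = "toric_ring n \<Gamma> :: 'k mpoly ring"
  let ?G = "xt n ` {F \<in> \<Gamma>. 0 < w (expo n F)} :: 'k mpoly set"
  interpret cring ?R by (rule cring_toric_ring)
  have "?G \<subseteq> positive_part n \<Gamma> w"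
    using xt_in_toric_ring by (auto simp: positive_part_def) (simp add: xt_eq_single)
  then show "genideal ?R ?G \<subseteq> positive_part n \<Gamma> w"
    by (rule genideal_minimal[OF ideal_positive_part])
  have G: "?G \<subseteq> carrier ?R" using xt_in_toric_ring by auto
  interpret I: ideal "genideal ?R ?G" ?R by (rule genideal_ideal[OF G])
  show "positive_part n \<Gamma> w \<subseteq> genideal ?R ?G"
  proof
    fix r :: "'k mpoly" assume r: "r \<in> positive_part n \<Gamma> w"
    \<comment> \<open>The ring contains the constants and every monomial occurring in
      \<open>r\<close>, so the terms of \<open>r\<close> can be treated one by one.\<close>
    have terms: "Poly_Mapping.single m c \<in> genideal ?R ?G" if "m \<in> Poly_Mapping.keys r" for m c
    proof -
      have "Poly_Mapping.single m (1::'k) \<in> genideal ?R ?G"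
        using monomial_in_genideal keys_toric_ring[of r n \<Gamma>] r that
        unfolding positive_part_def by blast
      then have "const c \<otimes>\<^bsub>?R\<^esub> Poly_Mapping.single m 1 \<in> genideal ?R ?G"
        using const_in_toric_ring by (rule I.I_l_closed)
      then show ?thesis by (simp add: const_def mult_single)
    qed
    have "(\<Sum>m\<in>A. Poly_Mapping.single m (Poly_Mapping.lookup r m)) \<in> genideal ?R ?G"
      if "finite A" "A \<subseteq> Poly_Mapping.keys r" for A
      using that
    proof (induction rule: finite_induct)
      case empty
      then show ?case using I.zero_closed by simp
    next
      case (insert a A)
      then show ?case using I.a_closed[OF terms[of a "Poly_Mapping.lookup r a"]] by simp
    qed
    from this[of "Poly_Mapping.keys r"] show "r \<in> genideal ?R ?G"
      by (simp flip: poly_mapping_sum_terms)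
  qed
qed

text \<open>The components of degree \<open>0\<close> of two elements multiply to the one of their product.\<close>

lemma primeideal_positive_part:
  "primeideal (positive_part n \<Gamma> w :: 'k::field mpoly set) (toric_ring n \<Gamma>)"
proof (rule primeidealI[OF ideal_positive_part cring_toric_ring])
  let ?R = "toric_ring n \<Gamma> :: 'k mpoly ring"
  interpret cring ?R by (rule cring_toric_ring)
  have "1 \<notin> (positive_part n \<Gamma> w :: 'k mpoly set)"
    by (simp add: positive_part_def weight_zero)
  then show "carrier ?R \<noteq> positive_part n \<Gamma> w" using one_closed by auto
  fix a b assume a: "a \<in> carrier ?R" and b: "b \<in> carrier ?R"
    and "a \<otimes>\<^bsub>?R\<^esub> b \<in> positive_part n \<Gamma> w"
  then have ab: "0 < w m" if "m \<in> Poly_Mapping.keys (a * b)" for m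
    using that by (simp add: positive_part_def)
  \<comment> \<open>\<open>lo\<close> is the component of degree 0; for \<open>p\<close> in the
    ring, \<open>hi\<close> collects the terms of positive degree.\<close>
  define lo hi :: "'k mpoly \<Rightarrow> 'k mpoly" where
    "lo p = (\<Sum>m\<in>{m \<in> Poly_Mapping.keys p. w m = 0}.
        Poly_Mapping.single m (Poly_Mapping.lookup p m))"
    and "hi p = p - lo p" for p
  have lookup_lo: "Poly_Mapping.lookup (lo p) m = (if w m = 0 then Poly_Mapping.lookup p m else 0)"
    for p m
    by (auto simp: lo_def lookup_sum lookup_single when_def in_keys_iff)
  have lo_key: "w m = 0" if "m \<in> Poly_Mapping.keys (lo p)" for m p
    using that by (auto simp: in_keys_iff lookup_lo split: if_splits)
  have hi_key: "0 < w m" if "m \<in> Poly_Mapping.keys (hi p)" "p \<in> carrier ?R" for m p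
  proof -
    have "m \<in> Poly_Mapping.keys p" "w m \<noteq> 0"
      using that(1) by (auto simp: in_keys_iff lookup_lo hi_def lookup_minus split: if_splits)
    then show ?thesis
      using weight_toric_exps_nonneg keys_toric_ring[OF that(2)] by force
  qed
  \<comment> \<open>This identity forces \<open>lo a * lo b\<close> to vanish: its terms have weight
    0, while the three products on the right have only terms of positive weight.\<close>
  have "lo a * lo b = a * b - (hi a * b + lo a * hi b)"
    by (simp add: hi_def algebra_simps)
  have False if m: "m \<in> Poly_Mapping.keys (lo a * lo b)" for m
  proof -
    have "w m = 0" using m keys_mult[of "lo a" "lo b"] by (auto simp: w_add lo_key)
    moreover have "m \<in> Poly_Mapping.keys (a * b) \<or> m \<in> Poly_Mapping.keys (hi a * b)
        \<or> m \<in> Poly_Mapping.keys (lo a * hi b)"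
      using m unfolding \<open>lo a * lo b = _\<close>
      by (auto simp: in_keys_iff lookup_minus lookup_add)
    then have "0 < w m"
    proof (elim disjE)
      assume "m \<in> Poly_Mapping.keys (hi a * b)"
      then obtain x y where "m = x + y" "x \<in> Poly_Mapping.keys (hi a)" "y \<in> Poly_Mapping.keys b"
        using keys_mult[of "hi a" b] by auto
      moreover from this have "0 \<le> w y"
        using keys_toric_ring[OF b] weight_toric_exps_nonneg by blast
      ultimately show ?thesis using hi_key[OF _ a, of x] by (simp add: w_add)
    next
      assume "m \<in> Poly_Mapping.keys (lo a * hi b)"
      then obtain x y where "m = x + y" "x \<in> Poly_Mapping.keys (lo a)"
        "y \<in> Poly_Mapping.keys (hi b)"
        using keys_mult[of "lo a" "hi b"] by auto
      then show ?thesis using hi_key[OF _ b, of y] lo_key[of x a] by (simp add: w_add)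
    qed (rule ab)
    ultimately show False by simp
  qed
  then have "lo a * lo b = 0" by (metis all_not_in_conv keys_eq_empty)
  then have "lo a = 0 \<or> lo b = 0" by simp
  moreover have "p \<in> positive_part n \<Gamma> w" if "p \<in> carrier ?R" "lo p = 0" for p
    using hi_key[of _ p] that by (simp add: hi_def positive_part_def)
  ultimately show "a \<in> positive_part n \<Gamma> w \<or> b \<in> positive_part n \<Gamma> w"
    using a b by blast
qed

end

section \<open>Unit-interval complexes\<close>

locale unit_interval =
  fixes n d :: nat and \<Delta> :: "nat set set"
  assumes complex: "unit_interval_complex n d \<Delta>" and d_ge_2: "2 \<le> d"
begin

lemma finite_facet: "F \<in> facets \<Delta> \<Longrightarrow> finite F"
  using complex finite_subset[of F "{1..n}"]
  by (auto simp: unit_interval_complex_def simplicial_complex_on_def facets_def)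

lemma card_facet: "F \<in> facets \<Delta> \<Longrightarrow> card F = d"
  using complex by (auto simp: unit_interval_complex_def pure_def)

lemma clique_facet: "F \<in> facets \<Delta> \<Longrightarrow> clique n d \<Delta> {Min F..Max F}"
  using complex by (simp add: unit_interval_complex_def)

text \<open>All facets have \<open>d\<close> elements, so a set of at most \<open>d\<close> elements
  can contain no facet other than itself.\<close>

lemma Ind_if_card:
  assumes "F \<subseteq> {1..n}" "card F \<le> d" "F \<notin> facets \<Delta>"
  shows "F \<in> Ind n \<Delta>"
proof -
  have "\<not> G \<subseteq> F" if "G \<in> facets \<Delta>" for G
  proof
    assume "G \<subseteq> F"
    moreover have "finite F" using assms(1) finite_subset by blast
    ultimately have "G = F" using card_facet[OF that] assms(2) card_seteq by metis
    then show False using that assms(3) by blast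
  qed
  then show ?thesis using assms(1) by (simp add: Ind_def)
qed

lemma Ind_mono: "F \<in> Ind n \<Delta> \<Longrightarrow> G \<subseteq> F \<Longrightarrow> G \<in> Ind n \<Delta>"
  unfolding Ind_def by blast

lemma Ind_if_card_less: "F \<subseteq> {1..n} \<Longrightarrow> card F < d \<Longrightarrow> F \<in> Ind n \<Delta>"
  using Ind_if_card card_facet by (metis less_imp_le nat_neq_iff)

context
  fixes B :: "nat set"
  assumes maximal: "B \<in> maximal_cliques n d \<Delta>"
begin

lemma clique_sub: "B \<subseteq> {1..n}" and card_clique: "d \<le> card B" and finite_clique: "finite B"
  using maximal finite_subset[of B "{1..n}"] by (auto simp: maximal_cliques_def clique_def)

text \<open>Any \<open>d\<close> elements of a clique form a facet. The bound makes
  \<open>lin_form\<close> nonnegative on all generators.\<close>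

lemma card_Ind_inter_clique:
  assumes "F \<in> Ind n \<Delta>"
  shows "card (F \<inter> B) < d"
proof (rule ccontr)
  assume "\<not> card (F \<inter> B) < d"
  then obtain G where "G \<subseteq> F \<inter> B" "card G = d"
    by (meson not_less obtain_subset_with_card_n)
  then have "G \<in> facets \<Delta>" using maximal by (simp add: maximal_cliques_def clique_def)
  then show False using assms \<open>G \<subseteq> F \<inter> B\<close> by (auto simp: Ind_def)
qed

lemma maximal_clique_eq: "clique n d \<Delta> C \<Longrightarrow> B \<subseteq> C \<Longrightarrow> C = B"
  using maximal by (simp add: maximal_cliques_def)

text \<open>Since \<open>2 \<le> d\<close>, some facet inside \<open>B\<close> contains both ends of
  \<open>B\<close>. Its interval is a clique containing \<open>B\<close>, so maximality
  applies.\<close>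

lemma maximal_clique_interval: "B = {Min B..Max B}"
proof -
  have ne: "B \<noteq> {}" using card_clique d_ge_2 by auto
  have "card {Min B, Max B} \<le> 2" by (simp add: card_insert_if)
  then obtain F where F: "{Min B, Max B} \<subseteq> F" "F \<subseteq> B" "card F = d"
    using exists_subset_between[of "{Min B, Max B}" d B] d_ge_2 card_clique finite_clique ne
    by auto
  then have fac: "F \<in> facets \<Delta>" using maximal by (simp add: maximal_cliques_def clique_def)
  have "finite F" using fac by (rule finite_facet)
  then have "Min F = Min B" "Max F = Max B"
    using F finite_clique ne by (auto intro!: Min_eqI Max_eqI)
  then have "clique n d \<Delta> {Min B..Max B}" using clique_facet[OF fac] by simp
  then show ?thesis using maximal_clique_eq[of "{Min B..Max B}"] finite_clique ne by fastforce
qed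

text \<open>Supplies the partner for exchanging \<open>i\<close> out of a set: \<open>xt n G\<close>
  has weight 0, and independence of \<open>insert i G\<close> keeps the new factor in the
  ring.\<close>

lemma outside_extension:
  assumes "i \<in> {1..n}" "i \<notin> B"
  obtains G where "G \<subseteq> B" "card G = d - 1" "insert i G \<in> Ind n \<Delta>"
proof -
  have ne: "B \<noteq> {}" using card_clique d_ge_2 by auto
  \<comment> \<open>The end of \<open>B\<close> on the far side from \<open>i\<close>: any interval
    containing \<open>i\<close> and \<open>e\<close> covers \<open>B\<close>.\<close>
  define e where "e = (if i < Min B then Max B else Min B)"
  have e: "e \<in> B" using finite_clique ne by (simp add: e_def)
  have "card {e} \<le> d - 1" "d - 1 \<le> card B" using d_ge_2 card_clique by simp_all
  then obtain G where G: "{e} \<subseteq> G" "G \<subseteq> B" "card G = d - 1"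
    using exists_subset_between[of "{e}" "d - 1" B] e finite_clique by blast
  have finG: "finite G" using G finite_clique finite_subset by blast
  have out: "i < Min B \<or> Max B < i"
    using assms(2) maximal_clique_interval by (metis atLeastAtMost_iff not_le)
  have "insert i G \<notin> facets \<Delta>"
  proof
    assume fac: "insert i G \<in> facets \<Delta>"
    define a b where "a = Min (insert i G)" and "b = Max (insert i G)"
    have ab: "i \<in> {a..b}" "e \<in> {a..b}" using finG G(1) by (auto simp: a_def b_def)
    have "B \<subseteq> {a..b}"
    proof
      fix x assume "x \<in> B"
      then have "Min B \<le> x" "x \<le> Max B" using finite_clique by auto
      then show "x \<in> {a..b}" using out ab by (cases "i < Min B") (auto simp: e_def)
    qed
    moreover have "clique n d \<Delta> {a..b}" using clique_facet[OF fac] by (simp add: a_def b_def)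
    ultimately have "{a..b} = B" using maximal_clique_eq by blast
    then show False using ab(1) assms(2) by blast
  qed
  moreover have "card (insert i G) \<le> d"
    using G(3) card_insert_le_m1[of d G i] d_ge_2 by simp
  moreover have "insert i G \<subseteq> {1..n}" using assms(1) G(2) clique_sub by auto
  ultimately have "insert i G \<in> Ind n \<Delta>" by (intro Ind_if_card)
  then show thesis using that G by blast
qed

end

end

section \<open>Exchange in prime ideals\<close>

text \<open>The sum of the exponent vectors records the multiset union of the two sets, which moving
  \<open>i\<close> does not alter.\<close>

lemma expo_exchange:
  assumes "finite F" "finite G" "i \<in> F" "i \<notin> G"
  shows "expo n F + expo n G = expo n (F - {i}) + expo n (insert i G)"
  using assms by (simp add: expo_def sum.remove[of F i] algebra_simps)

lemma xt_exchange:
  assumes "finite F" "finite G" "i \<in> F" "i \<notin> G"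
  shows "xt n F * xt n G = xt n (F - {i}) * xt n (insert i G)"
  using expo_exchange[OF assms] by (simp add: xt_eq_single mult_single)

context unit_interval
begin

context
  fixes B :: "nat set" and Q :: "'k::field mpoly set"
  assumes maximal: "B \<in> maximal_cliques n d \<Delta>"
    and prime: "primeideal Q (toric_ring n (Ind n \<Delta>))"
    and t_in_Q: "indet (n + 1) \<in> Q"
    and notin_Q: "\<And>G. G \<in> Ind n \<Delta> \<Longrightarrow> card (G \<inter> B) = d - 1 \<Longrightarrow> xt n G \<notin> Q"
begin

lemma xt_prime_cases:
  assumes "xt n F' * xt n G' = (xt n F * xt n G :: 'k mpoly)" "xt n F \<in> Q"
    "F' \<in> Ind n \<Delta>" "G' \<in> Ind n \<Delta>" "G \<in> Ind n \<Delta>"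
  shows "xt n F' \<in> Q \<or> xt n G' \<in> Q"
proof -
  interpret primeideal Q "toric_ring n (Ind n \<Delta>)" by (rule prime)
  have "xt n F * xt n G \<in> Q"
    using I_r_closed[OF assms(2) xt_in_toric_ring[OF assms(5)]] by simp
  then show ?thesis
    using I_prime[OF xt_in_toric_ring[OF assms(3)] xt_in_toric_ring[OF assms(4)]] assms(1)
    by simp
qed

lemma xt_in_prime:
  assumes "F \<in> Ind n \<Delta>" "card (F \<inter> B) < d - 1"
  shows "xt n F \<in> Q"
  using assms
proof (induction "card F" arbitrary: F rule: less_induct)
  case less
  have Fn: "F \<subseteq> {1..n}" using less.prems(1) by (simp add: Ind_def)
  then have finF: "finite F" using finite_subset by blast
  note finB = finite_clique[OF maximal] and Bn = clique_sub[OF maximal]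
  \<comment> \<open>Deleting an element never raises \<open>card (F \<inter> B)\<close>. This gives
    the factor in \<open>Q\<close> that starts both exchange cases.\<close>
  have smaller: "xt n (F - {i}) \<in> Q" if "i \<in> F" for i
  proof (rule less.hyps)
    show "card (F - {i}) < card F" using finF that by (rule card_Diff1_less)
    show "F - {i} \<in> Ind n \<Delta>" using less.prems(1) Ind_mono by blast
    have "card ((F - {i}) \<inter> B) \<le> card (F \<inter> B)" using finF by (intro card_mono) auto
    then show "card ((F - {i}) \<inter> B) < d - 1" using less.prems(2) by simp
  qed
  consider "F = {}" | i where "i \<in> F" "i \<notin> B" | j where "j \<in> F" "F \<subseteq> B" by blast
  then show ?case
  proof cases
    case 1
    then show ?thesis using t_in_Q by (simp add: xt_def)
  next
    case 2
    then obtain G where G: "G \<subseteq> B" "card G = d - 1" "insert i G \<in> Ind n \<Delta>"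
      using outside_extension[OF maximal] Fn by blast
    have "G \<in> Ind n \<Delta>" using G(3) Ind_mono by blast
    moreover have "finite G" using G(1) finB finite_subset by blast
    ultimately have "xt n F \<in> Q \<or> xt n G \<in> Q"
      using xt_prime_cases[OF xt_exchange smaller] finF 2 G less.prems(1) by blast
    moreover have "xt n G \<notin> Q"
      using G \<open>G \<in> Ind n \<Delta>\<close> by (intro notin_Q) (auto simp: Int_absorb2)
    ultimately show ?thesis by blast
  next
    case 3
    have cF: "card F < d - 1" using less.prems(2) 3 by (simp add: Int_absorb2)
    then have "\<not> B \<subseteq> F" using card_clique[OF maximal] card_mono[OF finF, of B] by auto
    then obtain k where k: "k \<in> B" "k \<notin> F" by blast
    \<comment> \<open>\<open>F'\<close> has as many elements as \<open>F\<close>, so the induction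
      hypothesis does not reach it; the first exchange only shows that \<open>Q\<close> contains one
      of \<open>xt n F\<close> and \<open>xt n F'\<close>.\<close>
    define F' where "F' = insert k (F - {j})"
    have F': "F' \<subseteq> B" "card F' < d - 1" "finite F'" "j \<notin> F'" "k \<in> F'" "insert j F' = insert k F"
      using 3 k cF finF card_gt_0_iff[of F] by (auto simp: F'_def card_Diff_singleton)
    have Ind: "A \<in> Ind n \<Delta>" if "A \<subseteq> B" "card A \<le> d - 1" for A
      using that Bn d_ge_2 by (intro Ind_if_card_less) auto
    have "xt n F * xt n F' = (xt n (F - {j}) * xt n (insert k F) :: 'k mpoly)"
      using xt_exchange[OF finF F'(3) 3(1) F'(4)] F'(6) by simp
    \<comment> \<open>The strict bound on \<open>card F\<close> matters here: adding
      \<open>k\<close> still leaves at most \<open>d - 1\<close> elements.\<close>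
    moreover have "insert k F \<in> Ind n \<Delta>" using k cF 3 finF by (intro Ind) auto
    ultimately have "xt n F \<in> Q \<or> xt n F' \<in> Q"
      using xt_prime_cases smaller[OF 3(1)] less.prems(1) Ind[of F'] F' by auto
    moreover have "xt n F \<in> Q" if "xt n F' \<in> Q"
    proof -
      \<comment> \<open>As \<open>d \<le> card B\<close>, removing \<open>j\<close> leaves at least
        \<open>d - 1\<close> elements, enough for a \<open>G\<close> of weight 0 that contains
        \<open>k\<close> and avoids \<open>j\<close>.\<close>
      have "{k} \<subseteq> B - {j}" "card {k} \<le> d - 1" "d - 1 \<le> card (B - {j})"
        using k 3 card_clique[OF maximal] finB d_ge_2 by (auto simp: card_Diff_singleton)
      then obtain G where G: "{k} \<subseteq> G" "G \<subseteq> B - {j}" "card G = d - 1"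
        using exists_subset_between[of "{k}" "d - 1" "B - {j}"] finB by blast
      have finG: "finite G" using G(2) finB finite_subset by blast
      let ?G' = "insert j (G - {k})"
      have G': "?G' \<subseteq> B" "card ?G' = d - 1"
        using G 3 finG d_ge_2 by (auto simp: card_insert_if card_Diff_singleton)
      have G'_ins: "insert k ?G' = insert j G" using G by auto
      \<comment> \<open>Both products are compared with one through \<open>insert j G\<close>. This
        set consists of \<open>d\<close> elements of \<open>B\<close> and is a facet, so the
        intermediate product serves only as an identity of polynomials, not as a product of
        generators.\<close>
      have "F' - {k} = F - {j}" using k by (auto simp: F'_def)
      then have "xt n F' * xt n ?G' = (xt n (F - {j}) * xt n (insert j G) :: 'k mpoly)"
        using xt_exchange[of F' ?G' k n] F' finG k 3 G'_ins by auto
      moreover have "xt n F * xt n G = (xt n (F - {j}) * xt n (insert j G) :: 'k mpoly)"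
        using xt_exchange[of F G j n] finF finG 3 G by auto
      ultimately have "xt n F * xt n G = (xt n F' * xt n ?G' :: 'k mpoly)" by simp
      moreover have "G \<subseteq> B" using G(2) by blast
      then have "G \<in> Ind n \<Delta>" using G(3) by (intro Ind) simp_all
      moreover have "?G' \<in> Ind n \<Delta>" using G' by (intro Ind) simp_all
      ultimately have "xt n F \<in> Q \<or> xt n G \<in> Q"
        using that less.prems(1) xt_prime_cases by blast
      moreover have "xt n G \<notin> Q"
        using notin_Q \<open>G \<in> Ind n \<Delta>\<close> \<open>G \<subseteq> B\<close> G(3) by (simp add: Int_absorb2)
      ultimately show ?thesis by blast
    qed
    ultimately show ?thesis by blast
  qed
qed

end

end

section \<open>The ideals \<open>L\<^sub>j\<close>\<close>

text \<open>Coordinate \<open>n + 1\<close> lies outside \<open>B\<close> and \<open>F\<close>, so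
  it contributes exactly \<open>d - 1\<close>.\<close>

lemma lin_form_pt:
  assumes "F \<subseteq> {1..n}" "B \<subseteq> {1..n}"
  shows "lin_form n d B (pt n F) = int d - 1 - int (card (F \<inter> B))"
proof -
  have fin: "finite F" "finite B" using assms finite_subset by blast+
  have "pt n F k = (if k \<in> F then 1 else 0)" if "k \<in> B" for k
  proof -
    have "k \<noteq> n + 1" using that assms(2) by auto
    then show ?thesis using fin by (simp add: pt_def basis_vec_def)
  qed
  then have "(\<Sum>k\<in>B. pt n F k) = (\<Sum>k\<in>B. if k \<in> F then 1 else 0)" by (rule sum.cong[OF refl])
  also have "\<dots> = int (card (F \<inter> B))" using fin by (simp add: sum.If_cases Int_commute)
  finally have "(\<Sum>k\<in>B. pt n F k) = int (card (F \<inter> B))" .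
  moreover have "n + 1 \<notin> F" using assms(1) by auto
  then have "pt n F (n + 1) = 1"
    using fin by (simp add: pt_def basis_vec_def)
  ultimately show ?thesis by (simp add: lin_form_def)
qed

text \<open>The linear form read on exponent vectors of arbitrary monomials: the grading to which
  the results on \<open>positive_part\<close> are applied.\<close>

definition weight :: "nat \<Rightarrow> nat \<Rightarrow> nat set \<Rightarrow> (nat \<Rightarrow>\<^sub>0 nat) \<Rightarrow> int" where
  "weight n d B m = lin_form n d B (\<lambda>k. int (Poly_Mapping.lookup m k))"

lemma weight_add: "weight n d B (a + b) = weight n d B a + weight n d B b"
  by (simp add: weight_def lin_form_def lookup_add sum.distrib algebra_simps)

lemma weight_expo: "weight n d B (expo n F) = lin_form n d B (pt n F)"
proof -
  have "(\<lambda>k. int (Poly_Mapping.lookup (expo n F) k)) = pt n F"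
    by (auto simp: expo_def pt_def basis_vec_def lookup_add lookup_sum lookup_single when_def
        eq_commute fun_eq_iff intro!: sum.cong)
  then show ?thesis by (simp add: weight_def)
qed

section \<open>Generation by monomials\<close>

lemma xt_in_monomials:
  assumes "F \<subseteq> {1..n}"
  shows "xt n F \<in> (monomials n :: 'k::field mpoly set)"
proof -
  have "(\<Prod>i\<in>{1..n}. indet i ^ (if i \<in> F then 1 else 0)) = (\<Prod>i\<in>F. indet i :: 'k mpoly)"
    using assms by (intro prod.mono_neutral_cong_right) auto
  then have "xt n F = (\<Prod>i\<in>{1..n}. indet i ^ (if i \<in> F then 1 else 0)) *
      (indet (n + 1) :: 'k mpoly) ^ 1"
    by (simp only: xt_def power_one_right)
  then show ?thesis
    unfolding monomials_def
    by (intro CollectI exI[of _ "\<lambda>i. if i \<in> F then 1 else 0"] exI[of _ 1]) simp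
qed

lemma monomial_ideal_L_ideal:
  assumes "\<Gamma> \<subseteq> Pow {1..n}"
  shows "monomial_ideal n \<Gamma> (L_ideal n d \<Gamma> B :: 'k::field mpoly set)"
proof -
  let ?G = "xt n ` {F \<in> \<Gamma>. lin_form n d B (pt n F) > 0} :: 'k mpoly set"
  have "xt n F \<in> monomials n \<inter> (carrier (toric_ring n \<Gamma>) :: 'k mpoly set)" if "F \<in> \<Gamma>" for F
    using that assms by (intro IntI xt_in_monomials xt_in_toric_ring) auto
  then have "?G \<subseteq> monomials n \<inter> carrier (toric_ring n \<Gamma>)" by blast
  then show ?thesis
    unfolding monomial_ideal_def L_ideal_def by (intro exI[of _ ?G]) simp
qed

section \<open>Minimality over the ideal generated by t\<close>

context unit_interval
begin

lemma minimal_prime_L_ideal: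
  assumes maximal: "B \<in> maximal_cliques n d \<Delta>"
  defines "R \<equiv> toric_ring n (Ind n \<Delta>) :: 'k::field mpoly ring"
  shows "minimal_prime_of R (genideal R {indet (n + 1)}) (L_ideal n d (Ind n \<Delta>) B)"
proof -
  let ?w = "weight n d B" and ?\<Gamma> = "Ind n \<Delta>"
  let ?P = "positive_part n ?\<Gamma> ?w :: 'k mpoly set"
  let ?G = "xt n ` {F \<in> ?\<Gamma>. lin_form n d B (pt n F) > 0} :: 'k mpoly set"
  interpret cring R unfolding R_def by (rule cring_toric_ring)
  have form: "lin_form n d B (pt n F) = int d - 1 - int (card (F \<inter> B))" if "F \<in> ?\<Gamma>" for F
    using that clique_sub[OF maximal] by (intro lin_form_pt) (auto simp: Ind_def)
  have nonneg: "0 \<le> ?w (expo n F)" if "F \<in> ?\<Gamma>" for F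
    using card_Ind_inter_clique[OF maximal that] by (simp add: weight_expo form that)
  have L_eq: "L_ideal n d ?\<Gamma> B = ?P"
    using genideal_eq_positive_part[of ?w ?\<Gamma> n, OF weight_add nonneg]
    by (simp add: L_ideal_def weight_expo)
  \<comment> \<open>The empty set yields t, where the form takes the value \<open>d - 1 > 0\<close>;
    hence t is among the generators of \<open>L_ideal\<close>.\<close>
  have empty: "{} \<in> ?\<Gamma>" using d_ge_2 by (intro Ind_if_card_less) auto
  have t: "indet (n + 1) = (xt n {} :: 'k mpoly)" by (simp add: xt_def)
  have t_carrier: "indet (n + 1) \<in> carrier R"
    unfolding t R_def using empty by (rule xt_in_toric_ring)
  have "indet (n + 1) \<in> ?G" unfolding t using empty form[OF empty] d_ge_2 by auto
  then have "indet (n + 1) \<in> genideal R ?G"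
    using genideal_self[of ?G] xt_in_toric_ring by (auto simp: R_def)
  then have "indet (n + 1) \<in> ?P" using L_eq by (simp add: L_ideal_def R_def)
  then have tP: "genideal R {indet (n + 1)} \<subseteq> ?P"
    using genideal_minimal[of ?P "{indet (n + 1)}"]
      ideal_positive_part[of ?w ?\<Gamma> n, OF weight_add nonneg]
    by (simp add: R_def)
  have "Q = ?P" if Q: "primeideal Q R" "genideal R {indet (n + 1)} \<subseteq> Q" "Q \<subseteq> ?P" for Q
  proof -
    have "ideal Q R" using Q(1) by (rule primeideal.axioms)
    have tQ: "indet (n + 1) \<in> Q" using Q(2) genideal_self'[OF t_carrier] by blast
    \<comment> \<open>The form vanishes at such \<open>G\<close>, whereas
      \<open>Q \<subseteq> ?P\<close> admits only positive weights.\<close>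
    have notin: "xt n G \<notin> Q" if "G \<in> ?\<Gamma>" "card (G \<inter> B) = d - 1" for G
    proof
      assume "xt n G \<in> Q"
      then have "0 < ?w (expo n G)" using Q(3) by (auto simp: positive_part_def xt_eq_single)
      then show False using that d_ge_2 by (simp add: weight_expo form)
    qed
    \<comment> \<open>With every generator of \<open>L_ideal\<close> in \<open>Q\<close>, the
      inclusion reverse to \<open>Q \<subseteq> ?P\<close> follows.\<close>
    have "?G \<subseteq> Q"
      using xt_in_prime[OF maximal Q(1)[unfolded R_def] tQ notin] by (auto simp: form)
    then have "genideal R ?G \<subseteq> Q" by (rule genideal_minimal[OF \<open>ideal Q R\<close>])
    then show ?thesis using Q(3) L_eq by (simp add: L_ideal_def R_def)
  qed
  then show ?thesis
    using tP primeideal_positive_part[of ?w ?\<Gamma> n, OF weight_add nonneg]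
    unfolding minimal_prime_of_def L_eq by (auto simp: R_def)
qed

end

theorem theorem3p1:
  fixes n d m :: nat and \<Delta> \<Gamma> :: "nat set set" and B :: "nat \<Rightarrow> nat set"
    and R :: "'k::field mpoly ring" and t :: "'k mpoly"
  assumes "unit_interval_complex n d \<Delta>"
    and "complex_dim \<Delta> = int d - 1" and "int d - 1 > 1"
    and "bij_betw B {1..m} (maximal_cliques n d \<Delta>)"
  defines "\<Gamma> \<equiv> Ind n \<Delta>" and "R \<equiv> toric_ring n \<Gamma>" and "t \<equiv> indet (n + 1)"
  shows "\<forall>j\<in>{1..m}. monomial_ideal n \<Gamma> (L_ideal n d \<Gamma> (B j) :: 'k mpoly set) \<and>
                     minimal_prime_of R (genideal R {t}) (L_ideal n d \<Gamma> (B j))"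
proof
  fix j assume "j \<in> {1..m}"
  then have "B j \<in> maximal_cliques n d \<Delta>" using bij_betw_apply[OF assms(4)] by blast
  moreover have "unit_interval n d \<Delta>" using assms by unfold_locales auto
  moreover have "\<Gamma> \<subseteq> Pow {1..n}" by (auto simp: \<Gamma>_def Ind_def)
  ultimately show "monomial_ideal n \<Gamma> (L_ideal n d \<Gamma> (B j) :: 'k mpoly set) \<and>
      minimal_prime_of R (genideal R {t}) (L_ideal n d \<Gamma> (B j))"
    unfolding R_def t_def \<Gamma>_def
    by (intro conjI monomial_ideal_L_ideal unit_interval.minimal_prime_L_ideal)
qed

end
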